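(* Let $(X,d)$ be a metric space and $T:X\to\mathcal{CB}(X)$. Suppose there exist a metric-preserving function $f:[0,\infty)\to[0,\infty)$ and $k\in(0,1)$ such that the following conditions hold: (a) for all $x,y\in X$, $f(H(Tx,Ty))\le k\,d(x,y)$; (b) $f'(0)>k$. Then there exists $c\in(0,1)$ such that for all sufficiently small $\varepsilon>0$, $T$ is an $(\varepsilon,c)$-uniform local multivalued contraction on $(X,d)$.
   Context: A function $f:[0,\infty)\to[0,\infty)$ is metric-preserving if for every metric space $(Y,\rho)$, the composition $f\circ\rho$ is a metric on $Y$. For a metric-preserving $f$, $f'(0)$ denotes the one-sided derivative $\lim_{y\to0^+}\frac{f(y)-f(0)}{y}=\lim_{y\to0^+}\frac{f(y)}{y}$ (note $f(0)=0$); it is a known fact that this limit always exists in $\mathbb R\cup\{+\infty\}$, and the value $+\infty$ is allowed. $\mathcal{CB}(X)$ is the family of nonempty, closed and bounded subsets of $X$, with Hausdorff distance $H(A,B)=\max\{\sup_{x\in A}d(x,B),\sup_{x\in B}d(x,A)\}$, where $d(x,B)=\inf_{y\in B}d(x,y)$. For $\varepsilon>0$ and $c\in(0,1)$, $T:X\to\mathcal{CB}(X)$ is an $(\varepsilon,c)$-uniform local multivalued contraction if for all $x,y\in X$, $d(x,y)<\varepsilon$ implies $H(Tx,Ty)\le c\,d(x,y)$. *)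

theory Defs
  imports "HOL-Analysis.Analysis"
begin

text \<open>
  Functions on \<open>[0,\<infinity>)\<close> are functions on the reals whose values at negative arguments are
  irrelevant.

  HOL cannot quantify over all types inside a definition, so the metric spaces below have
  carriers of type \<^typ>\<open>real set\<close>. This loses nothing: lemma
  \<open>metric_preserving_Metric_space\<close> gives the defining property for metric spaces over an
  arbitrary type.
\<close>

definition metric_preserving :: "(real \<Rightarrow> real) \<Rightarrow> bool" where
  "metric_preserving f \<longleftrightarrow>
     f \<in> {0..} \<rightarrow> {0..} \<and>
     (\<forall>(Y :: real set) \<rho>. Metric_space Y \<rho> \<longrightarrow> Metric_space Y (\<lambda>x y. f (\<rho> x y)))"

lemma metric_preserving_Metric_space:
  fixes Y :: "'b set"
  assumes f: "metric_preserving f" and Y: "Metric_space Y \<rho>"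
  shows "Metric_space Y (\<lambda>x y. f (\<rho> x y))"
proof -
  interpret Y: Metric_space Y \<rho> by (fact Y)
  have three: "(f (\<rho> x y) = 0 \<longleftrightarrow> x = y) \<and> f (\<rho> x z) \<le> f (\<rho> x y) + f (\<rho> y z)"
    if xyz: "x \<in> Y" "y \<in> Y" "z \<in> Y" for x y z
  proof -
    define g :: "real \<Rightarrow> 'b" where "g t = (if t = 0 then x else if t = 1 then y else z)" for t
    have "{x, y, z} \<subseteq> g ` {0, 1, 2}"
      by (auto simp: g_def)
    then obtain U where U: "inj_on g U" "{x, y, z} = g ` U"
      unfolding subset_image_inj by blast
    have inY: "g a \<in> Y" if "a \<in> U" for a
    proof -
      have "g a \<in> {x, y, z}"
        unfolding U(2) using that by simp
      then show ?thesis
        using xyz by auto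
    qed
    have "Metric_space U (\<lambda>a b. \<rho> (g a) (g b))"
      by unfold_locales (use inY U(1) in \<open>auto simp: Y.commute Y.triangle inj_on_eq_iff\<close>)
    then have "Metric_space U (\<lambda>a b. f (\<rho> (g a) (g b)))"
      using f unfolding metric_preserving_def by blast
    then interpret U: Metric_space U "\<lambda>a b. f (\<rho> (g a) (g b))" .
    obtain a b c where "a \<in> U" "b \<in> U" "c \<in> U" "x = g a" "y = g b" "z = g c"
      using U(2) by (metis imageE insertCI)
    then show ?thesis
      using U.zero[of a b] U.triangle[of a b c] U(1) by (auto simp: inj_on_eq_iff)
  qed
  show ?thesis
    by unfold_locales
      (use three f in \<open>auto simp: metric_preserving_def Y.commute Pi_iff\<close>)
qed

text \<open>
  The one-sided derivative at \<open>0\<close>, valued in the extended reals so that \<open>\<infinity>\<close> is allowed. The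
  limit exists for every metric-preserving function; for other functions the value may be
  unspecified.
\<close>

definition right_deriv_0 :: "(real \<Rightarrow> real) \<Rightarrow> ereal" where
  "right_deriv_0 f = Lim (at_right 0) (\<lambda>y. ereal ((f y - f 0) / y))"

context Metric_space
begin

definition CB :: "'a set set" where
  "CB = {A. A \<noteq> {} \<and> closedin mtopology A \<and> mbounded A}"

definition point_dist :: "'a \<Rightarrow> 'a set \<Rightarrow> real" where
  "point_dist x B = (INF y\<in>B. d x y)"

text \<open>The infima and suprema are over nonempty, bounded sets of reals when \<open>A\<close> and \<open>B\<close> are
  in \<open>CB\<close>, the only case of interest.\<close>

definition Hausdorff_dist :: "'a set \<Rightarrow> 'a set \<Rightarrow> real" where
  "Hausdorff_dist A B = max (SUP x\<in>A. point_dist x B) (SUP x\<in>B. point_dist x A)"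

definition uniform_local_multivalued_contraction ::
  "real \<Rightarrow> real \<Rightarrow> ('a \<Rightarrow> 'a set) \<Rightarrow> bool" where
  "uniform_local_multivalued_contraction \<epsilon> c T \<longleftrightarrow>
     0 < \<epsilon> \<and> 0 < c \<and> c < 1 \<and> T \<in> M \<rightarrow> CB \<and>
     (\<forall>x\<in>M. \<forall>y\<in>M. d x y < \<epsilon> \<longrightarrow> Hausdorff_dist (T x) (T y) \<le> c * d x y)"

end

end

theory Submission
  imports Defs
begin

text \<open>
  Applying \<open>f\<close> to a triangle with sides \<open>a\<close>, \<open>b\<close>, \<open>c\<close> gives \<open>f a \<le> f b + f c\<close>. In particular
  \<open>f a \<le> 2 * f b\<close> for \<open>a \<le> 2 * b\<close>, and inductively \<open>f y \<le> n * f x\<close> for \<open>y \<le> n * x\<close> and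
  \<open>n \<ge> 2\<close>. Choosing \<open>n \<le> y / x + 2\<close> yields \<open>f y / (y + 2 * x) \<le> f x / x\<close>, so that, as
  \<open>x \<rightarrow> 0\<close>, the quotient \<open>f x / x\<close> tends to its supremum, which is therefore \<open>f'(0)\<close>. Hence
  \<open>f t \<ge> m * t\<close> near \<open>0\<close> for some \<open>m > k\<close>. Moreover \<open>f\<close> is bounded away from \<open>0\<close> outside any
  neighbourhood of \<open>0\<close>, so \<open>H(Tx,Ty)\<close> is small whenever \<open>d(x,y)\<close> is, and then
  \<open>m * H(Tx,Ty) \<le> k * d(x,y)\<close>.
\<close>

lemma metric_preserving_zero_iff:
  assumes "metric_preserving f" "0 \<le> a"
  shows "f a = 0 \<longleftrightarrow> a = 0"
proof -
  have "Metric_space (UNIV :: real set) (\<lambda>x y. f (dist x y))"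
    using assms(1) Met_TC.Metric_space_axioms unfolding metric_preserving_def by blast
  then show ?thesis
    using Metric_space.zero[of UNIV "\<lambda>x y. f (dist x y)" a 0] assms(2) by (simp add: dist_real_def)
qed

lemma metric_preserving_pos:
  assumes "metric_preserving f" "0 < a"
  shows "0 < f a"
proof -
  have "0 \<le> f a"
    using assms by (auto simp: metric_preserving_def Pi_iff)
  then show ?thesis
    using metric_preserving_zero_iff[of f a] assms by linarith
qed

text \<open>Three points with pairwise distances \<open>a\<close>, \<open>b\<close>,
  \<open>c\<close> form a metric space, and \<open>f\<close> keeps its triangle inequality.\<close>

lemma metric_preserving_triangle_triplet:
  assumes f: "metric_preserving f"
    and pos: "0 < a" "0 < b" "0 < c"
    and tri: "a \<le> b + c" "b \<le> a + c" "c \<le> a + b"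
  shows "f a \<le> f b + f c"
proof -
  \<comment> \<open>On the points 0, 1, 2 the sum \<open>x + y\<close> identifies each pair of
    distinct points, so the formula is visibly symmetric.\<close>
  define \<rho> :: "real \<Rightarrow> real \<Rightarrow> real" where
    "\<rho> x y = (if x = y then 0 else if x + y = 1 then b else if x + y = 2 then a else c)" for x y
  have "Metric_space {0, 1, 2} \<rho>"
    by unfold_locales (use pos tri in \<open>auto simp: \<rho>_def\<close>)
  then have "Metric_space {0, 1, 2} (\<lambda>x y. f (\<rho> x y))"
    using f unfolding metric_preserving_def by blast
  from Metric_space.triangle[OF this, of 0 1 2] show ?thesis
    by (simp add: \<rho>_def)
qed

text \<open>The triangle is isosceles with base \<open>a\<close> and legs \<open>b\<close>. This
  replaces monotonicity, which \<open>f\<close> may lack.\<close>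

lemma metric_preserving_le_double:
  assumes "metric_preserving f" "0 < a" "a \<le> 2 * b"
  shows "f a \<le> 2 * f b"
  using metric_preserving_triangle_triplet[of f a b b] assms by simp

lemma metric_preserving_le_mult:
  assumes f: "metric_preserving f" and x: "0 < x" and n: "2 \<le> n"
    and y: "0 < y" "y \<le> real n * x"
  shows "f y \<le> real n * f x"
  using n y
proof (induction n arbitrary: y rule: dec_induct)
  case base
  then show ?case
    using metric_preserving_le_double[OF f] by simp
next
  case (step n)
  show ?case
  proof (cases "y \<le> 2 * x")
    case True
    then have "f y \<le> 2 * f x"
      using metric_preserving_le_double[OF f] step.prems by simp
    also have "\<dots> \<le> real (Suc n) * f x"
      using step.hyps metric_preserving_pos[OF f x] by (intro mult_right_mono) auto
    finally show ?thesis .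
  next
    case False
    have "f y \<le> f (y - x) + f x"
      using metric_preserving_triangle_triplet[OF f, of y "y - x" x] False x by simp
    moreover have "f (y - x) \<le> real n * f x"
      using step.IH[of "y - x"] step.prems False x by (simp add: algebra_simps)
    ultimately show ?thesis
      by (simp add: algebra_simps)
  qed
qed

lemma metric_preserving_quotient_ge:
  assumes f: "metric_preserving f" and x: "0 < x" and y: "0 < y"
  shows "f y / (y + 2 * x) \<le> f x / x"
proof -
  \<comment> \<open>The summand 2 forces \<open>2 \<le> n\<close> even when
    \<open>y < x\<close>.\<close>
  define n where "n = nat \<lfloor>y / x\<rfloor> + 2"
  have "0 \<le> y / x"
    using x y by simp
  then have n: "y / x \<le> real n" "real n \<le> y / x + 2"
    unfolding n_def by linarith+
  have "f y \<le> real n * f x"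
    by (rule metric_preserving_le_mult[OF f x _ y])
      (use n x in \<open>simp_all add: n_def[symmetric] divide_le_eq\<close>, simp add: n_def)
  also have "\<dots> \<le> (y / x + 2) * f x"
    using n metric_preserving_pos[OF f x] by (intro mult_right_mono) auto
  finally show ?thesis
    using x y by (simp add: field_simps)
qed

lemma metric_preserving_quotient_tendsto_SUP:
  assumes f: "metric_preserving f"
  shows "((\<lambda>x. ereal (f x / x)) \<longlongrightarrow> (SUP y\<in>{0<..}. ereal (f y / y))) (at_right 0)"
proof (rule order_tendstoI)
  fix a assume "a < (SUP y\<in>{0<..}. ereal (f y / y))"
  then obtain y where y: "0 < y" "a < ereal (f y / y)"
    by (auto simp: less_SUP_iff)
  \<comment> \<open>Here \<open>y\<close> stays fixed, so the lower bound for \<open>f x / x\<close>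
    tends to \<open>f y / y\<close>, which exceeds \<open>a\<close>.\<close>
  have "((\<lambda>x. f y / (y + 2 * x)) \<longlongrightarrow> f y / (y + 2 * 0)) (at_right 0)"
    by (intro tendsto_intros) (use y in auto)
  then have "((\<lambda>x. ereal (f y / (y + 2 * x))) \<longlongrightarrow> ereal (f y / y)) (at_right 0)"
    by simp
  from order_tendstoD(1)[OF this y(2)] eventually_at_right_less[of 0]
  show "\<forall>\<^sub>F x in at_right 0. a < ereal (f x / x)"
  proof eventually_elim
    case (elim x)
    with metric_preserving_quotient_ge[OF f _ y(1), of x] show ?case
      by (metis ereal_less_eq(3) less_le_trans)
  qed
next
  fix a assume a: "(SUP y\<in>{0<..}. ereal (f y / y)) < a"
  from eventually_at_right_less[of 0] show "\<forall>\<^sub>F x in at_right 0. ereal (f x / x) < a"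
  proof eventually_elim
    case (elim x)
    then have "ereal (f x / x) \<le> (SUP y\<in>{0<..}. ereal (f y / y))"
      by (intro SUP_upper) auto
    with a show ?case
      by simp
  qed
qed

text \<open>\<open>Lim\<close> names the limit only once convergence is known; the supremum supplies
  it.\<close>

lemma metric_preserving_tendsto_right_deriv_0:
  assumes f: "metric_preserving f"
  shows "((\<lambda>x. ereal (f x / x)) \<longlongrightarrow> right_deriv_0 f) (at_right 0)"
proof -
  have "f 0 = 0"
    using metric_preserving_zero_iff[OF f] by simp
  then have "right_deriv_0 f = (SUP y\<in>{0<..}. ereal (f y / y))"
    unfolding right_deriv_0_def
    using metric_preserving_quotient_tendsto_SUP[OF f] by (intro tendsto_Lim) auto
  then show ?thesis
    using metric_preserving_quotient_tendsto_SUP[OF f] by simp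
qed

theorem theorem30:
  fixes X :: "'a set" and d :: "'a \<Rightarrow> 'a \<Rightarrow> real" and T :: "'a \<Rightarrow> 'a set"
  assumes "Metric_space X d"
    and "T \<in> X \<rightarrow> Metric_space.CB X d"
    and "\<exists>f k. metric_preserving f \<and> 0 < k \<and> k < 1 \<and>
           (\<forall>x\<in>X. \<forall>y\<in>X. f (Metric_space.Hausdorff_dist d (T x) (T y)) \<le> k * d x y) \<and>
           right_deriv_0 f > ereal k"
  shows "\<exists>c. 0 < c \<and> c < 1 \<and>
           (\<forall>\<^sub>F \<epsilon> in at_right 0.
              Metric_space.uniform_local_multivalued_contraction X d \<epsilon> c T)"
proof -
  interpret X: Metric_space X d by (fact assms(1))
  obtain f k where f: "metric_preserving f" and k: "0 < k" "k < 1"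
    and contr: "\<And>x y. x \<in> X \<Longrightarrow> y \<in> X \<Longrightarrow> f (X.Hausdorff_dist (T x) (T y)) \<le> k * d x y"
    and deriv: "ereal k < right_deriv_0 f"
    using assms(3) by blast
  \<comment> \<open>A real \<open>m\<close> is chosen because the derivative may be infinite;
    \<open>k < m\<close> makes \<open>k / m\<close> a contraction constant.\<close>
  obtain m where m: "k < m" "ereal m < right_deriv_0 f"
    using ereal_dense2[OF deriv] by auto
  have "\<forall>\<^sub>F t in at_right 0. ereal m < ereal (f t / t)"
    using order_tendstoD(1)[OF metric_preserving_tendsto_right_deriv_0[OF f] m(2)] .
  then obtain b where b: "0 < b" and quot: "\<And>t. 0 < t \<Longrightarrow> t < b \<Longrightarrow> m < f t / t"
    unfolding eventually_at_right_field by auto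
  \<comment> \<open>Chosen so that \<open>2 * (k * \<delta>) = f b\<close>, which rules out
    Hausdorff distances of at least \<open>b\<close> when \<open>d x y < \<delta>\<close>.\<close>
  define \<delta> where "\<delta> = f b / (2 * k)"
  have \<delta>: "0 < \<delta>"
    using metric_preserving_pos[OF f b] k by (simp add: \<delta>_def)
  have "X.uniform_local_multivalued_contraction \<epsilon> (k / m) T" if \<epsilon>: "0 < \<epsilon>" "\<epsilon> < \<delta>" for \<epsilon>
  proof -
    have "X.Hausdorff_dist (T x) (T y) \<le> k / m * d x y"
      if xy: "x \<in> X" "y \<in> X" "d x y < \<epsilon>" for x y
    \<comment> \<open>The quotient bound \<open>quot\<close> speaks only of positive
      arguments.\<close>
    proof (cases "0 < X.Hausdorff_dist (T x) (T y)")
      case False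
      moreover have "0 \<le> k / m * d x y"
        using k m by simp
      ultimately show ?thesis
        by linarith
    next
      case True
      let ?H = "X.Hausdorff_dist (T x) (T y)"
      have "?H < b"
      proof (rule ccontr)
        assume "\<not> ?H < b"
        then have "f b \<le> 2 * f ?H"
          using metric_preserving_le_double[OF f b] b by simp
        also have "\<dots> \<le> 2 * (k * d x y)"
          using contr[OF xy(1,2)] by simp
        also have "\<dots> < 2 * (k * \<delta>)"
          using xy(3) \<epsilon> k by simp
        also have "\<dots> = f b"
          using k by (simp add: \<delta>_def)
        finally show False
          by simp
      qed
      then have "m * ?H < f ?H"
        using quot[OF True] True by (simp add: field_simps)
      then have "m * ?H \<le> k * d x y"
        using contr[OF xy(1,2)] by linarith
      then show ?thesis
        using k m by (simp add: field_simps)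
    qed
    then show ?thesis
      using k m \<epsilon> assms(2) by (simp add: X.uniform_local_multivalued_contraction_def)
  qed
  then have "\<forall>\<^sub>F \<epsilon> in at_right 0. X.uniform_local_multivalued_contraction \<epsilon> (k / m) T"
    using \<delta> unfolding eventually_at_right_field by blast
  then show ?thesis
    using k m by (intro exI[of _ "k / m"]) simp
qed

end
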